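(* Let $q\in[1,\infty)$ and $p\in(q,\infty]$. Then $\ell_p$ does not embed coarsely into any $q$-barycentric metric space.
   Context: For a set $\Omega$, let $\mathscr{P}^{<\infty}_\Omega$ be the set of finitely supported probability measures on $\Omega$. A barycenter map is a function $\mathfrak{B}:\mathscr{P}^{<\infty}_\Omega\to\Omega$ with $\mathfrak{B}(\delta_x)=x$ for all $x\in\Omega$. For $q\in[1,\infty)$ and $\beta\in(0,\infty)$, a metric space $(X,d_X)$ is $q$-barycentric with constant $\beta$ if there is a barycenter map $\mathfrak{B}:\mathscr{P}^{<\infty}_X\to X$ such that for every $x\in X$ and $\mu\in\mathscr{P}^{<\infty}_X$, $d_X(\mathfrak{B}(\mu),x)^q+\beta^{-q}\int_X d_X(\mathfrak{B}(\mu),y)^q\,d\mu(y)\le \int_X d_X(x,y)^q\,d\mu(y)$; it is $q$-barycentric if this holds for some $\beta$. A metric space $(Y,d_Y)$ embeds coarsely into $(X,d_X)$ if there exist nondecreasing $\omega,\Omega:[0,\infty)\to[0,\infty)$ with $\omega\le\Omega$ pointwise and $\lim_{t\to\infty}\omega(t)=\infty$, and a map $f:Y\to X$ with $\omega(d_Y(x,y))\le d_X(f(x),f(y))\le\Omega(d_Y(x,y))$ for all $x,y\in Y$. *)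

theory Defs
  imports "HOL-Analysis.Analysis" "HOL-Probability.Probability_Mass_Function"
begin

definition fin_prob :: "'a set \<Rightarrow> 'a pmf set" where
  "fin_prob X = {\<mu>. finite (set_pmf \<mu>) \<and> set_pmf \<mu> \<subseteq> X}"

definition barycenter_map :: "'a set \<Rightarrow> ('a pmf \<Rightarrow> 'a) \<Rightarrow> bool" where
  "barycenter_map X B \<longleftrightarrow> (\<forall>\<mu>\<in>fin_prob X. B \<mu> \<in> X) \<and> (\<forall>x\<in>X. B (return_pmf x) = x)"

definition q_barycentric_const :: "'a set \<Rightarrow> ('a \<Rightarrow> 'a \<Rightarrow> real) \<Rightarrow> real \<Rightarrow> real \<Rightarrow> bool" where
  "q_barycentric_const X d q \<beta> \<longleftrightarrow> (\<exists>B. barycenter_map X B \<and>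
     (\<forall>x\<in>X. \<forall>\<mu>\<in>fin_prob X.
        d (B \<mu>) x powr q + \<beta> powr (-q) * (\<Sum>y\<in>set_pmf \<mu>. pmf \<mu> y * d (B \<mu>) y powr q)
          \<le> (\<Sum>y\<in>set_pmf \<mu>. pmf \<mu> y * d x y powr q)))"

definition q_barycentric :: "'a set \<Rightarrow> ('a \<Rightarrow> 'a \<Rightarrow> real) \<Rightarrow> real \<Rightarrow> bool" where
  "q_barycentric X d q \<longleftrightarrow> (\<exists>\<beta>>0. q_barycentric_const X d q \<beta>)"

definition coarse_embeds :: "'b set \<Rightarrow> ('b \<Rightarrow> 'b \<Rightarrow> real) \<Rightarrow> 'a set \<Rightarrow> ('a \<Rightarrow> 'a \<Rightarrow> real) \<Rightarrow> bool" where
  "coarse_embeds Y dY X dX \<longleftrightarrow> (\<exists>(\<omega>::real \<Rightarrow> real) (\<Omega>::real \<Rightarrow> real) f.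
     mono_on {0..} \<omega> \<and> mono_on {0..} \<Omega> \<and>
     (\<forall>t\<ge>0. 0 \<le> \<omega> t \<and> 0 \<le> \<Omega> t \<and> \<omega> t \<le> \<Omega> t) \<and>
     filterlim \<omega> at_top at_top \<and>
     f ` Y \<subseteq> X \<and>
     (\<forall>x\<in>Y. \<forall>y\<in>Y. \<omega> (dY x y) \<le> dX (f x) (f y) \<and> dX (f x) (f y) \<le> \<Omega> (dY x y)))"

definition lp_set :: "ereal \<Rightarrow> (nat \<Rightarrow> real) set" where
  "lp_set p = (if p = \<infinity> then {x. bounded (range x)}
               else {x. summable (\<lambda>n. \<bar>x n\<bar> powr real_of_ereal p)})"

definition lp_dist :: "ereal \<Rightarrow> (nat \<Rightarrow> real) \<Rightarrow> (nat \<Rightarrow> real) \<Rightarrow> real" where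
  "lp_dist p x y = (if p = \<infinity> then (SUP n. \<bar>x n - y n\<bar>)
                    else (\<Sum>n. \<bar>x n - y n\<bar> powr real_of_ereal p) powr (1 / real_of_ereal p))"

end

theory Submission
  imports Defs "HOL-Real_Asymp.Real_Asymp"
begin

text \<open>
  Let $f$ map the discrete torus $\mathbb{Z}_{4j}^n$, realised by roots of unity, into a
  $q$-barycentric space $X$, and let $f_k$ be obtained from $f$ by successively replacing, for each
  coordinate $i < k$, the value at $x$ by the barycenter of the values at $x \pm e_i$. The barycentric
  inequality telescopes along $k$ and bounds
  $\sum_k \mathbb{E}\, d(f_k(x + e_k), f_k(x - e_k))^q$ by
  $\mathbb{E}\, d(f(x), f(x + \varepsilon))^q$ for some signs $\varepsilon$, with no loss in the
  dimension. As $f_k$ stays close to $f$, walking $j$ double steps to the antipode in direction $k$ gives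
  $n (A - 2R)^q \lesssim j^q R^q$ whenever $f$ moves antipodes by at least $A$ and neighbours by at
  most $R$. A product of $n$ circles of radius about $j\, n^{-1/p}$ in $\ell_p$ with $n \approx j^q$ has
  neighbours at bounded distance and antipodes at distance about $j^{1 - q/p} \to \infty$, so a
  coarse embedding would violate this inequality.
\<close>

section \<open>Power inequalities and the barycentric inequality for two points\<close>

lemma powr_sum_le_sum_powr:
  fixes a :: "'i \<Rightarrow> real"
  assumes "q \<ge> 1" "\<And>i. i \<in> I \<Longrightarrow> 0 \<le> a i" "finite I"
  shows "(\<Sum>i\<in>I. a i) powr q \<le> real (card I) powr (q - 1) * (\<Sum>i\<in>I. a i powr q)"
proof -
  \<comment> \<open>Vanishing terms are discarded so that Jensen's inequality for the convex
    function \<open>t powr q\<close> is applied at positive points only.\<close>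
  define S where "S = {i \<in> I. a i > 0}"
  have S: "finite S" "S \<subseteq> I" "\<And>i. i \<in> I - S \<Longrightarrow> a i = 0"
    using assms by (force simp: S_def)+
  have sums: "(\<Sum>i\<in>I. a i) = (\<Sum>i\<in>S. a i)" "(\<Sum>i\<in>I. a i powr q) = (\<Sum>i\<in>S. a i powr q)"
    by (rule sum.mono_neutral_right; use assms S in simp)+
  show ?thesis
  proof (cases "S = {}")
    case True
    then show ?thesis by (simp add: sums)
  next
    case False
    define N where "N = real (card S)"
    have N: "N > 0" using False S by (simp add: N_def card_gt_0_iff)
    have "(\<Sum>i\<in>S. (1 / N) *\<^sub>R a i) powr q \<le> (\<Sum>i\<in>S. (1 / N) * a i powr q)"
    proof (rule convex_on_sum[OF S(1) False powr_convex[OF assms(1)]])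
      show "(\<Sum>i\<in>S. 1 / N) = 1" using N by (simp add: N_def)
    qed (use N in \<open>auto simp: S_def\<close>)
    then have "((\<Sum>i\<in>S. a i) / N) powr q \<le> (\<Sum>i\<in>S. a i powr q) / N"
      by (simp add: sum_divide_distrib)
    moreover have "0 \<le> (\<Sum>i\<in>S. a i)"
      by (intro sum_nonneg) (simp add: S_def)
    ultimately have "(\<Sum>i\<in>S. a i) powr q \<le> N powr q / N * (\<Sum>i\<in>S. a i powr q)"
      using N by (simp add: powr_divide field_simps)
    also have "\<dots> = N powr (q - 1) * (\<Sum>i\<in>S. a i powr q)"
      using N by (simp add: powr_diff)
    also have "\<dots> \<le> real (card I) powr (q - 1) * (\<Sum>i\<in>S. a i powr q)"
      using assms S unfolding N_def
      by (intro mult_right_mono powr_mono2) (auto intro!: sum_nonneg card_mono)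
    finally show ?thesis by (simp add: sums)
  qed
qed

lemma powr_add_le_double:
  fixes u v q :: real
  assumes "0 \<le> u" "0 \<le> v" "0 \<le> q"
  shows "(u + v) powr q \<le> 2 powr q * (u powr q + v powr q)"
proof -
  have "(u + v) powr q \<le> (2 * max u v) powr q"
    using assms by (intro powr_mono2) auto
  also have "\<dots> = 2 powr q * max u v powr q"
    using assms by (simp add: powr_mult)
  also have "\<dots> \<le> 2 powr q * (u powr q + v powr q)"
    by (intro mult_left_mono) (auto simp: max_def)
  finally show ?thesis .
qed

text \<open>Barycenters of uniform measures on at most two points are all that the argument uses. By
  the triangle inequality \<open>a\<close> and \<open>b\<close> cannot both be close to their
  barycenter, so the variance term dominates a multiple of \<open>d a b powr q\<close>.\<close>

lemma q_barycentric_midpoint: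
  assumes "Metric_space X d" "q_barycentric X d q" "1 \<le> q"
  obtains c m where "c > 0" "\<And>a b. a \<in> X \<Longrightarrow> b \<in> X \<Longrightarrow> m a b \<in> X"
    "\<And>a b x. a \<in> X \<Longrightarrow> b \<in> X \<Longrightarrow> x \<in> X \<Longrightarrow>
      d (m a b) x powr q + c * d a b powr q \<le> (d a x powr q + d b x powr q) / 2"
proof -
  interpret Metric_space X d by fact
  obtain \<beta> B where \<beta>: "\<beta> > 0" and B: "barycenter_map X B"
    and ineq: "\<And>x \<mu>. x \<in> X \<Longrightarrow> \<mu> \<in> fin_prob X \<Longrightarrow>
        d (B \<mu>) x powr q + \<beta> powr (-q) * (\<Sum>y\<in>set_pmf \<mu>. pmf \<mu> y * d (B \<mu>) y powr q)
          \<le> (\<Sum>y\<in>set_pmf \<mu>. pmf \<mu> y * d x y powr q)"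
    using assms(2) unfolding q_barycentric_def q_barycentric_const_def by blast
  have two_point: "(\<Sum>y\<in>set_pmf (pmf_of_set {a, b}). pmf (pmf_of_set {a, b}) y * g y) = (g a + g b) / 2"
    for a b and g :: "'a \<Rightarrow> real"
    by (cases "a = b") (auto simp: pmf_of_set)
  define m where "m a b = B (pmf_of_set {a, b})" for a b
  \<comment> \<open>The factor 2 comes from the weights 1/2, and \<open>2 powr q\<close> from
    splitting \<open>d a b\<close> at the midpoint with \<open>powr_add_le_double\<close>.\<close>
  define c where "c = \<beta> powr (-q) / (2 * 2 powr q)"
  have fin: "pmf_of_set {a, b} \<in> fin_prob X" if "a \<in> X" "b \<in> X" for a b
    using that by (auto simp: fin_prob_def)
  show ?thesis
  proof (rule that[of c m])
    show "c > 0" using \<beta> by (simp add: c_def)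
    show mX: "m a b \<in> X" if "a \<in> X" "b \<in> X" for a b
      using fin[OF that] B by (auto simp: m_def barycenter_map_def)
    fix a b x assume X: "a \<in> X" "b \<in> X" "x \<in> X"
    have "d a b \<le> d (m a b) a + d (m a b) b"
      using triangle[of a "m a b" b] mX X by (simp add: commute)
    then have "d a b powr q \<le> (d (m a b) a + d (m a b) b) powr q"
      using assms(3) by (intro powr_mono2) auto
    also have "\<dots> \<le> 2 powr q * (d (m a b) a powr q + d (m a b) b powr q)"
      using assms(3) by (intro powr_add_le_double) auto
    finally have "c * d a b powr q \<le> c * (2 powr q * (d (m a b) a powr q + d (m a b) b powr q))"
      using \<open>c > 0\<close> by (intro mult_left_mono) auto
    also have "\<dots> = \<beta> powr (-q) * ((d (m a b) a powr q + d (m a b) b powr q) / 2)"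
      by (simp add: c_def)
    finally show "d (m a b) x powr q + c * d a b powr q \<le> (d a x powr q + d b x powr q) / 2"
      using ineq[OF X(3) fin[OF X(1,2)]] unfolding two_point m_def[symmetric]
      by (simp add: commute)
  qed
qed

section \<open>The discrete torus and its translations\<close>

definition rot :: "nat \<Rightarrow> complex \<Rightarrow> (nat \<Rightarrow> complex) \<Rightarrow> nat \<Rightarrow> complex" where
  "rot k z x = x(k := z * x k)"

text \<open>The group of \<open>n\<close>-tuples modulo \<open>N\<close>, written multiplicatively.
  Extensional functions make it a finite set, so expectations become plain sums.\<close>

definition torus :: "nat \<Rightarrow> nat \<Rightarrow> (nat \<Rightarrow> complex) set" where
  "torus n N = {..<n} \<rightarrow>\<^sub>E {z. z ^ N = 1}"

lemma rot_rot: "rot k z (rot k w x) = rot k (z * w) x"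
  by (simp add: rot_def fun_eq_iff)

lemma rot_one [simp]: "rot k 1 x = x"
  by (simp add: rot_def)

lemma rot_in_torus: "x \<in> torus n N \<Longrightarrow> k < n \<Longrightarrow> z ^ N = 1 \<Longrightarrow> rot k z x \<in> torus n N"
  by (auto simp: rot_def torus_def PiE_iff extensional_def power_mult_distrib)

text \<open>Translation invariance of counting measure: rotating back by \<open>inverse z\<close>
  inverts the map.\<close>

lemma sum_torus_rot:
  assumes "k < n" "z ^ N = 1" "N > 0"
  shows "(\<Sum>x\<in>torus n N. g (rot k z x)) = (\<Sum>x\<in>torus n N. g x)"
proof (rule sum.reindex_bij_betw)
  have "z \<noteq> 0" using assms by (auto simp: power_0_left)
  have "inverse z ^ N = 1" using assms by (simp add: power_inverse)
  show "bij_betw (rot k z) (torus n N) (torus n N)"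
    by (rule bij_betw_byWitness[where f' = "rot k (inverse z)"])
      (use assms \<open>z \<noteq> 0\<close> \<open>inverse z ^ N = 1\<close> in \<open>auto simp: rot_rot rot_in_torus\<close>)
qed

lemma finite_torus: "N > 0 \<Longrightarrow> finite (torus n N)"
  unfolding torus_def by (intro finite_PiE finite_roots_unity) auto

lemma torus_nonempty: "torus n N \<noteq> {}"
  by (auto simp: torus_def PiE_eq_empty_iff intro!: exI[of _ 1])

lemma torus_norm:
  assumes "x \<in> torus n N" "k < n" "N > 0"
  shows "norm (x k) = 1"
proof -
  have "x k ^ N = 1" using assms by (auto simp: torus_def)
  then show ?thesis using assms(3) power_eq_1_iff by blast
qed

section \<open>Smoothing by midpoints and the resulting cotype inequality\<close>

locale midpoint_space = Metric_space X d for X :: "'a set" and d +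
  fixes q c :: real and mid :: "'a \<Rightarrow> 'a \<Rightarrow> 'a"
  assumes q: "1 \<le> q" and c: "0 < c"
    and mid_in: "a \<in> X \<Longrightarrow> b \<in> X \<Longrightarrow> mid a b \<in> X"
    and mid_ineq: "a \<in> X \<Longrightarrow> b \<in> X \<Longrightarrow> x \<in> X \<Longrightarrow>
      d (mid a b) x powr q + c * d a b powr q \<le> (d a x powr q + d b x powr q) / 2"
begin

text \<open>Closed balls are midpoint convex, since the term with \<open>c\<close> may be dropped.
  This is what keeps smoothed maps close to the original one.\<close>

lemma mid_ball:
  assumes "a \<in> X" "b \<in> X" "z \<in> X" "d a z \<le> R" "d b z \<le> R"
  shows "d (mid a b) z \<le> R"
proof -
  have R: "0 \<le> R" using assms(4) nonneg[of a z] by linarith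
  have "d (mid a b) z powr q \<le> (d a z powr q + d b z powr q) / 2"
    using mid_ineq[OF assms(1-3)] c by (smt (verit) mult_nonneg_nonneg powr_ge_zero)
  also have "\<dots> \<le> R powr q"
    using powr_mono2[of q "d a z" R] powr_mono2[of q "d b z" R] assms q by simp
  finally show ?thesis
    using q R by (smt (verit) powr_less_mono2 nonneg)
qed

lemma dist_path_le:
  assumes "\<And>i. i \<le> m \<Longrightarrow> u i \<in> X"
  shows "d (u m) (u 0) \<le> (\<Sum>i<m. d (u (Suc i)) (u i))"
  using assms
proof (induction m)
  case 0
  then show ?case by simp
next
  case (Suc m)
  have "d (u (Suc m)) (u 0) \<le> d (u (Suc m)) (u m) + d (u m) (u 0)"
    by (rule triangle) (use Suc.prems in auto)
  with Suc show ?case by simp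
qed

text \<open>Stage \<open>k\<close> is an iterated midpoint of values of \<open>f\<close> at points
  obtained by rotating each of the first \<open>k\<close> coordinates one step either way. The
  nesting order is fixed because iterated midpoints need not commute.\<close>

fun smooth :: "complex \<Rightarrow> ((nat \<Rightarrow> complex) \<Rightarrow> 'a) \<Rightarrow> nat \<Rightarrow> (nat \<Rightarrow> complex) \<Rightarrow> 'a" where
  "smooth z f 0 x = f x"
| "smooth z f (Suc k) x = mid (smooth z f k (rot k z x)) (smooth z f k (rot k (inverse z) x))"

context
  fixes n N :: nat and z :: complex and f :: "(nat \<Rightarrow> complex) \<Rightarrow> 'a"
  assumes N: "N > 0" and z: "z ^ N = 1" and f: "f \<in> torus n N \<rightarrow> X"
begin

lemma inverse_root: "inverse z ^ N = 1"
  using z by (simp add: power_inverse)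

lemma norm_root: "norm z = 1"
  using z N power_eq_1_iff by blast

lemma norm_inverse_root_minus_1: "norm (inverse z - 1) = norm (z - 1)"
proof -
  have "z \<noteq> 0" using norm_root by auto
  then have "inverse z - 1 = inverse z * (1 - z)" by (simp add: algebra_simps)
  then show ?thesis by (simp add: norm_mult norm_inverse norm_root norm_minus_commute)
qed

lemma rot_z_in:
  assumes "x \<in> torus n N" "k < n"
  shows "rot k z x \<in> torus n N" "rot k (inverse z) x \<in> torus n N"
  using assms z inverse_root by (auto intro: rot_in_torus)

lemma smooth_in: "k \<le> n \<Longrightarrow> x \<in> torus n N \<Longrightarrow> smooth z f k x \<in> X"
  by (induction k arbitrary: x) (use f in \<open>auto simp: rot_z_in Suc_le_eq intro!: mid_in\<close>)

text \<open>A relaxation of "the first \<open>k\<close> coordinates are each rotated by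
  \<open>z\<close> or \<open>inverse z\<close>", phrased by norms to match the closeness hypothesis
  on \<open>f\<close> in \<open>cotype_inequality\<close>.\<close>

definition near :: "nat \<Rightarrow> (nat \<Rightarrow> complex) \<Rightarrow> (nat \<Rightarrow> complex) \<Rightarrow> bool" where
  "near k x y \<longleftrightarrow> (\<forall>i<k. norm (y i - x i) \<le> norm (z - 1)) \<and> (\<forall>i\<ge>k. y i = x i)"

lemma norm_rot_minus:
  assumes "x \<in> torus n N" "k < n"
  shows "norm (z * x k - x k) = norm (z - 1)" "norm (inverse z * x k - x k) = norm (z - 1)"
proof -
  have "w * x k - x k = (w - 1) * x k" for w by (simp add: algebra_simps)
  then show "norm (z * x k - x k) = norm (z - 1)" "norm (inverse z * x k - x k) = norm (z - 1)"
    using torus_norm[OF assms N] by (simp_all add: norm_mult norm_inverse_root_minus_1)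
qed

text \<open>Coordinate \<open>k\<close> is still untouched at stage \<open>k\<close>, so a rotation
  there may be absorbed. At the base point this serves the recursion of \<open>smooth\<close>; the
  companion at the endpoint serves the displacements in \<open>energy_sum_le\<close>.\<close>

lemma near_rot_left:
  assumes "x \<in> torus n N" "k < n" "w = z \<or> w = inverse z" "near k (rot k w x) y"
  shows "near (Suc k) x y"
  using assms norm_rot_minus[OF assms(1,2)]
  by (auto simp: near_def rot_def less_Suc_eq split: if_splits)

lemma near_rot_right:
  assumes "x \<in> torus n N" "k < n" "w = z \<or> w = inverse z" "near k x y"
  shows "near (Suc k) x (rot k w y)"
  using assms norm_rot_minus[OF assms(1,2)]
  by (auto simp: near_def rot_def less_Suc_eq split: if_splits)

lemma smooth_ball:
  assumes "k \<le> n" "x \<in> torus n N" "p \<in> X"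
    and "\<And>y. y \<in> torus n N \<Longrightarrow> near k x y \<Longrightarrow> d (f y) p \<le> R"
  shows "d (smooth z f k x) p \<le> R"
  using assms
proof (induction k arbitrary: x)
  case 0
  have "near 0 x x" by (simp add: near_def)
  with 0 show ?case by simp
next
  case (Suc k)
  then have k: "k < n" by simp
  have "d (smooth z f k (rot k w x)) p \<le> R" if "w = z \<or> w = inverse z" for w
  proof (rule Suc.IH)
    show "rot k w x \<in> torus n N" using that Suc.prems(2) k rot_z_in by blast
    show "d (f y) p \<le> R" if "y \<in> torus n N" "near k (rot k w x) y" for y
      using Suc.prems(4) near_rot_left[OF Suc.prems(2) k \<open>w = z \<or> w = inverse z\<close>] that by blast
  qed (use Suc.prems k in auto)
  then show ?case
    using Suc.prems k by (auto intro!: mid_ball smooth_in rot_z_in)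
qed

text \<open>The total gain from the \<open>c\<close>-terms of \<open>mid_ineq\<close> when passing
  from stage \<open>k\<close> to stage \<open>Suc k\<close>: a discrete gradient over double steps
  in direction \<open>k\<close>.\<close>

definition energy :: "nat \<Rightarrow> real" where
  "energy k = (\<Sum>x\<in>torus n N.
     d (smooth z f k (rot k z x)) (smooth z f k (rot k (inverse z) x)) powr q)"

text \<open>Of the two terms produced by each barycentric inequality only the larger is kept, so that a
  single displacement \<open>s\<close> takes the place of an average over all sign vectors.\<close>

lemma energy_sum_le:
  assumes "k \<le> n" "h \<in> torus n N \<rightarrow> X"
  shows "\<exists>s \<in> torus n N \<rightarrow> torus n N. (\<forall>x\<in>torus n N. near k x (s x)) \<and>
    (\<Sum>x\<in>torus n N. d (smooth z f k x) (h x) powr q) + c * (\<Sum>i<k. energy i)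
      \<le> (\<Sum>x\<in>torus n N. d (f x) (h (s x)) powr q)"
  using assms
proof (induction k arbitrary: h)
  case 0
  then show ?case by (intro bexI[of _ "\<lambda>x. x"]) (auto simp: near_def)
next
  case (Suc k)
  let ?T = "torus n N" and ?G = "smooth z f k"
  have k: "k < n" using Suc.prems by simp
  have z0: "z \<noteq> 0" using norm_root by auto
  define S where "S w = (\<Sum>x\<in>?T. d (?G x) (h (rot k w x)) powr q)" for w
  \<comment> \<open>Translation moves the rotation from the smoothed map onto \<open>h\<close>.
    Hence the induction has to run over arbitrary \<open>h\<close>.\<close>
  have shift: "(\<Sum>x\<in>?T. d (?G (rot k z x)) (h x) powr q) = S (inverse z)"
    "(\<Sum>x\<in>?T. d (?G (rot k (inverse z) x)) (h x) powr q) = S z"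
    unfolding S_def
    using sum_torus_rot[OF k z N, of "\<lambda>x. d (?G x) (h (rot k (inverse z) x)) powr q"]
      sum_torus_rot[OF k inverse_root N, of "\<lambda>x. d (?G x) (h (rot k z x)) powr q"] z0
    by (simp_all add: rot_rot)
  have "(\<Sum>x\<in>?T. d (smooth z f (Suc k) x) (h x) powr q) + c * energy k
    = (\<Sum>x\<in>?T. d (smooth z f (Suc k) x) (h x) powr q
        + c * d (?G (rot k z x)) (?G (rot k (inverse z) x)) powr q)"
    by (simp add: energy_def sum.distrib sum_distrib_left)
  also have "\<dots> \<le> (\<Sum>x\<in>?T. (d (?G (rot k z x)) (h x) powr q + d (?G (rot k (inverse z) x)) (h x) powr q) / 2)"
    unfolding smooth.simps
    by (intro sum_mono mid_ineq) (use k Suc.prems in \<open>auto intro!: smooth_in rot_z_in\<close>)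
  also have "\<dots> = (S (inverse z) + S z) / 2"
    by (simp add: shift sum.distrib flip: sum_divide_distrib)
  also have "\<dots> \<le> max (S (inverse z)) (S z)" by simp
  finally obtain w where w: "w = z \<or> w = inverse z"
    and le: "(\<Sum>x\<in>?T. d (smooth z f (Suc k) x) (h x) powr q) + c * energy k \<le> S w"
    by (metis max_def)
  have "(\<lambda>x. h (rot k w x)) \<in> ?T \<rightarrow> X"
    using Suc.prems(2) k w rot_z_in by blast
  with Suc.IH k obtain s where s: "s \<in> ?T \<rightarrow> ?T" "\<And>x. x \<in> ?T \<Longrightarrow> near k x (s x)"
    and IH: "S w + c * (\<Sum>i<k. energy i) \<le> (\<Sum>x\<in>?T. d (f x) (h (rot k w (s x))) powr q)"
    unfolding S_def by (meson less_imp_le)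
  show ?case
  proof (intro bexI[of _ "\<lambda>x. rot k w (s x)"] conjI ballI)
    show "(\<lambda>x. rot k w (s x)) \<in> ?T \<rightarrow> ?T"
      using s(1) k w rot_z_in by blast
    show "near (Suc k) x (rot k w (s x))" if "x \<in> ?T" for x
      using near_rot_right that k w s(2) by blast
  qed (use le IH in \<open>simp add: algebra_simps\<close>)
qed

text \<open>The energies are bounded above together, by telescoping, and below one by one, by
  walking to the antipode. The loss \<open>2 * R\<close> is the distance between \<open>f\<close>
  and its smoothing at the two ends of the walk.\<close>

lemma cotype_inequality:
  assumes "z ^ (2 * j) = -1" "j > 0"
    and close: "\<And>x y. x \<in> torus n N \<Longrightarrow> y \<in> torus n N \<Longrightarrow>
      (\<And>i. i < n \<Longrightarrow> norm (y i - x i) \<le> norm (z - 1)) \<Longrightarrow> d (f y) (f x) \<le> R"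
    and far: "\<And>x k. x \<in> torus n N \<Longrightarrow> k < n \<Longrightarrow> A \<le> d (f (rot k (-1) x)) (f x)"
    and "2 * R \<le> A"
  shows "c * (real n * (A - 2 * R) powr q) \<le> real j powr q * R powr q"
proof -
  let ?T = "torus n N" and ?G = "smooth z f"
  define t where "t = real (card ?T)"
  have t: "t > 0" using finite_torus[OF N] torus_nonempty by (simp add: t_def card_gt_0_iff)
  have z0: "z \<noteq> 0" using norm_root by auto
  have minus1: "(-1) ^ N = (1::complex)"
    using z by (metis assms(1) power_mult mult.commute power_one)
  have zi: "(z ^ i) ^ N = 1" for i
    using z by (metis power_mult mult.commute power_one)
  have near_close: "d (f y) (f x) \<le> R" if "x \<in> ?T" "y \<in> ?T" "near k x y" for x y k
    using that by (intro close) (auto simp: near_def not_less, metis norm_zero norm_ge_zero diff_self not_le)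
  have G_close: "d (?G k x) (f x) \<le> R" if "x \<in> ?T" "k \<le> n" for x k
    using that f by (intro smooth_ball near_close) auto
  have upper: "c * (\<Sum>k<n. energy k) \<le> t * R powr q"
  proof -
    obtain s where s: "s \<in> ?T \<rightarrow> ?T" "\<And>x. x \<in> ?T \<Longrightarrow> near n x (s x)"
      and le: "(\<Sum>x\<in>?T. d (?G n x) (f x) powr q) + c * (\<Sum>i<n. energy i)
        \<le> (\<Sum>x\<in>?T. d (f x) (f (s x)) powr q)"
      \<comment> \<open>Comparison with \<open>h = f\<close> itself: the right-hand side then sees
        only displacements between neighbours.\<close>
      using energy_sum_le[OF order_refl f] by blast
    have "(\<Sum>x\<in>?T. d (f x) (f (s x)) powr q) \<le> (\<Sum>x\<in>?T. R powr q)"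
    proof (intro sum_mono powr_mono2)
      show "d (f x) (f (s x)) \<le> R" if "x \<in> ?T" for x
        using near_close[OF that _ s(2)[OF that]] s(1) that by (auto simp: commute)
    qed (use q in auto)
    moreover have "0 \<le> (\<Sum>x\<in>?T. d (?G n x) (f x) powr q)"
      by (intro sum_nonneg) auto
    ultimately show ?thesis using le by (simp add: t_def)
  qed
  have lower: "t * (A - 2 * R) powr q \<le> real j powr q * energy k" if k: "k < n" for k
  proof -
    \<comment> \<open>The length of the \<open>i\<close>-th of \<open>j\<close> double steps; they
      end at the antipode because \<open>z ^ (2 * j) = -1\<close>.\<close>
    define D where "D i x = d (?G k (rot k (z ^ (2 * Suc i)) x)) (?G k (rot k (z ^ (2 * i)) x))" for i x
    have pointwise: "(A - 2 * R) powr q \<le> real j powr (q - 1) * (\<Sum>i<j. D i x powr q)"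
      if x: "x \<in> ?T" for x
    proof -
      have x': "rot k (-1) x \<in> ?T"
        using x k minus1 by (intro rot_in_torus) auto
      have in_X: "f x \<in> X" "f (rot k (-1) x) \<in> X" "?G k x \<in> X" "?G k (rot k (-1) x) \<in> X"
        using x x' f k by (auto intro!: smooth_in)
      have "A \<le> d (f (rot k (-1) x)) (f x)" using far x k by blast
      also have "\<dots> \<le> d (f (rot k (-1) x)) (?G k (rot k (-1) x)) + d (?G k (rot k (-1) x)) (f x)"
        using in_X by (intro triangle) auto
      also have "\<dots> \<le> d (f (rot k (-1) x)) (?G k (rot k (-1) x))
          + (d (?G k (rot k (-1) x)) (?G k x) + d (?G k x) (f x))"
        using in_X by (intro add_left_mono triangle) auto
      finally have "A - 2 * R \<le> d (?G k (rot k (-1) x)) (?G k x)"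
        using G_close[OF x, of k] G_close[OF x', of k] k by (simp add: commute)
      also have "\<dots> \<le> (\<Sum>i<j. D i x)"
        proof -
        have "?G k (rot k (z ^ (2 * i)) x) \<in> X" for i
          using x k zi by (intro smooth_in rot_in_torus) auto
        from dist_path_le[of j "\<lambda>i. ?G k (rot k (z ^ (2 * i)) x)", OF this] show ?thesis
          using assms(1) by (simp add: D_def)
      qed
      finally have "(A - 2 * R) powr q \<le> (\<Sum>i<j. D i x) powr q"
        using assms q by (intro powr_mono2) auto
      also have "\<dots> \<le> real (card {..<j}) powr (q - 1) * (\<Sum>i<j. D i x powr q)"
        using q by (intro powr_sum_le_sum_powr) (auto simp: D_def)
      finally show ?thesis by simp
    qed
    \<comment> \<open>Translating by the odd power \<open>z ^ (2 * i + 1)\<close>, the centre of the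
      double step, turns its two ends into rotations by \<open>z\<close> and
      \<open>inverse z\<close>.\<close>
    have D_sum: "(\<Sum>x\<in>?T. D i x powr q) = energy k" for i
      using sum_torus_rot[OF k zi N, of "\<lambda>x. d (?G k (rot k z x)) (?G k (rot k (inverse z) x)) powr q" "Suc (2 * i)"] z0
      by (simp add: D_def energy_def rot_rot flip: mult.assoc)
    have "t * (A - 2 * R) powr q \<le> (\<Sum>x\<in>?T. real j powr (q - 1) * (\<Sum>i<j. D i x powr q))"
      using sum_mono[OF pointwise, of ?T "\<lambda>x. x"] by (simp add: t_def)
    also have "\<dots> = real j powr (q - 1) * (\<Sum>i<j. \<Sum>x\<in>?T. D i x powr q)"
      by (subst sum.swap) (simp add: sum_distrib_left)
    also have "\<dots> = real j powr q * energy k"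
      using \<open>j > 0\<close> by (simp add: D_sum powr_diff)
    finally show ?thesis .
  qed
  have "t * (c * (real n * (A - 2 * R) powr q)) = c * (\<Sum>k<n. t * (A - 2 * R) powr q)"
    by simp
  also have "\<dots> \<le> c * (\<Sum>k<n. real j powr q * energy k)"
    using c lower by (intro mult_left_mono sum_mono) auto
  also have "\<dots> = real j powr q * (c * (\<Sum>k<n. energy k))"
    by (simp flip: sum_distrib_left)
  also have "\<dots> \<le> real j powr q * (t * R powr q)"
    using upper by (intro mult_left_mono) auto
  also have "\<dots> = t * (real j powr q * R powr q)" by simp
  finally show ?thesis using t by (simp only: mult_le_cancel_left_pos)
qed

end

end

section \<open>Distances in the sequence spaces and products of circles\<close>

text \<open>This is $1/p$, also for $p = \infty$.\<close>

definition inv_exponent :: "ereal \<Rightarrow> real" where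
  "inv_exponent p = (if p = \<infinity> then 0 else 1 / real_of_ereal p)"

lemma lp_dist_le:
  assumes "0 < p" "0 \<le> s" "\<And>i. \<bar>x i - y i\<bar> \<le> s" "\<And>i. i \<ge> N \<Longrightarrow> x i = y i" "N > 0"
  shows "lp_dist p x y \<le> real N powr inv_exponent p * s"
proof (cases "p = \<infinity>")
  case True
  then show ?thesis
    using assms by (auto simp: lp_dist_def inv_exponent_def intro!: cSUP_least)
next
  case False
  define r where "r = real_of_ereal p"
  have r: "r > 0" using assms False by (cases p) (auto simp: r_def)
  have sm: "summable (\<lambda>i. \<bar>x i - y i\<bar> powr r)"
    using assms r by (intro summable_finite[of "{..<N}"]) (auto simp: not_less)
  have "(\<Sum>i. \<bar>x i - y i\<bar> powr r) = (\<Sum>i<N. \<bar>x i - y i\<bar> powr r)"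
    using assms r by (intro suminf_finite) (auto simp: not_less)
  also have "\<dots> \<le> (\<Sum>i<N. s powr r)"
    using assms r by (intro sum_mono powr_mono2) auto
  finally have "(\<Sum>i. \<bar>x i - y i\<bar> powr r) powr (1 / r) \<le> (real N * s powr r) powr (1 / r)"
    using r assms by (intro powr_mono2) (auto intro!: suminf_nonneg sm)
  also have "\<dots> = real N powr (1 / r) * s"
    using r assms by (simp add: powr_mult powr_powr)
  finally show ?thesis using False by (simp add: lp_dist_def inv_exponent_def r_def)
qed

text \<open>Agreement from \<open>N\<close> on makes the supremum one of a bounded set and the
  series convergent, so either dominates a single coordinate.\<close>

lemma abs_diff_le_lp_dist:
  assumes "0 < p" "\<And>i. i \<ge> N \<Longrightarrow> x i = y i"
  shows "\<bar>x k - y k\<bar> \<le> lp_dist p x y"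
proof (cases "p = \<infinity>")
  case True
  have "range (\<lambda>i. \<bar>x i - y i\<bar>) \<subseteq> insert 0 ((\<lambda>i. \<bar>x i - y i\<bar>) ` {..<N})"
    using assms(2) by (auto simp: image_iff) (metis lessThan_iff not_less)
  then have "bdd_above (range (\<lambda>i. \<bar>x i - y i\<bar>))"
    by (rule bdd_above_mono[rotated]) auto
  then show ?thesis using True by (auto simp: lp_dist_def intro: cSUP_upper)
next
  case False
  define r where "r = real_of_ereal p"
  have r: "r > 0" using assms False by (cases p) (auto simp: r_def)
  have "\<bar>x k - y k\<bar> powr r = (\<Sum>i\<in>{k}. \<bar>x i - y i\<bar> powr r)" by simp
  also have "\<dots> \<le> (\<Sum>i. \<bar>x i - y i\<bar> powr r)"
    using assms r by (intro sum_le_suminf summable_finite[of "{..<N}"]) (auto simp: not_less)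
  finally have "(\<bar>x k - y k\<bar> powr r) powr (1 / r) \<le> (\<Sum>i. \<bar>x i - y i\<bar> powr r) powr (1 / r)"
    using r by (intro powr_mono2) auto
  then show ?thesis using False r by (simp add: lp_dist_def r_def powr_powr)
qed

lemma finite_support_in_lp_set:
  assumes "0 < p" "\<And>i. i \<ge> N \<Longrightarrow> x i = 0"
  shows "x \<in> lp_set p"
proof (cases "p = \<infinity>")
  case True
  have "range x \<subseteq> insert 0 (x ` {..<N})"
    using assms(2) by (auto simp: image_iff) (metis lessThan_iff not_less)
  then have "bounded (range x)"
    by (rule bounded_subset[rotated]) (auto intro!: finite_imp_bounded)
  then show ?thesis using True by (simp add: lp_set_def)
next
  case False
  then show ?thesis
    using assms summable_finite[of "{..<N}" "\<lambda>n. \<bar>x n\<bar> powr real_of_ereal p"]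
    by (auto simp: lp_set_def not_less)
qed

text \<open>A product of \<open>n\<close> circles of radius \<open>a\<close>, the
  \<open>k\<close>-th in the plane of coordinates \<open>2 * k\<close> and \<open>2 * k + 1\<close>,
  padded by zeros so that it lies in every \<open>lp_set p\<close> with
  \<open>0 < p\<close>.\<close>

definition circles :: "nat \<Rightarrow> real \<Rightarrow> (nat \<Rightarrow> complex) \<Rightarrow> nat \<Rightarrow> real" where
  "circles n a x i = (if i < 2 * n then a * (if even i then Re (x (i div 2)) else Im (x (i div 2))) else 0)"

lemma circles_in_lp_set: "0 < p \<Longrightarrow> circles n a x \<in> lp_set p"
  by (rule finite_support_in_lp_set[of _ "2 * n"]) (auto simp: circles_def)

lemma lp_dist_circles_le:
  assumes "0 < p" "0 \<le> a" "0 \<le> b" "n > 0" "\<And>k. k < n \<Longrightarrow> norm (y k - x k) \<le> b"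
  shows "lp_dist p (circles n a y) (circles n a x) \<le> real (2 * n) powr inv_exponent p * (a * b)"
proof (rule lp_dist_le)
  fix i
  show "\<bar>circles n a y i - circles n a x i\<bar> \<le> a * b"
  proof (cases "i < 2 * n")
    case True
    then have "norm (y (i div 2) - x (i div 2)) \<le> b" using assms by auto
    then have "\<bar>Re (y (i div 2)) - Re (x (i div 2))\<bar> \<le> b" "\<bar>Im (y (i div 2)) - Im (x (i div 2))\<bar> \<le> b"
      using abs_Re_le_cmod[of "y (i div 2) - x (i div 2)"] abs_Im_le_cmod[of "y (i div 2) - x (i div 2)"]
      by auto
    then show ?thesis
      using True assms(2) by (auto simp: circles_def abs_mult simp flip: right_diff_distrib intro!: mult_left_mono)
  qed (use assms in \<open>simp add: circles_def\<close>)
qed (use assms in \<open>auto simp: circles_def\<close>)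

text \<open>A unit complex number has real or imaginary part of modulus at least 1/2, and negation
  moves that part by at least 1. One coordinate suffices, so no dependence on \<open>p\<close> or
  \<open>n\<close> enters.\<close>

lemma lp_dist_circles_antipode_ge:
  assumes "0 < p" "0 \<le> a" "k < n" "norm (x k) = 1"
  shows "a \<le> lp_dist p (circles n a (rot k (-1) x)) (circles n a x)"
proof -
  have "\<bar>circles n a (rot k (-1) x) i - circles n a x i\<bar>
      \<le> lp_dist p (circles n a (rot k (-1) x)) (circles n a x)" for i
    by (rule abs_diff_le_lp_dist[where N = "2 * n"]) (use assms in \<open>auto simp: circles_def\<close>)
  from this[of "2 * k"] this[of "2 * k + 1"]
  have le: "a * (2 * \<bar>Re (x k)\<bar>) \<le> lp_dist p (circles n a (rot k (-1) x)) (circles n a x)"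
    "a * (2 * \<bar>Im (x k)\<bar>) \<le> lp_dist p (circles n a (rot k (-1) x)) (circles n a x)"
    using assms by (auto simp: circles_def rot_def abs_mult)
  have "1 \<le> 2 * \<bar>Re (x k)\<bar> \<or> 1 \<le> 2 * \<bar>Im (x k)\<bar>"
    using cmod_le[of "x k"] assms(4) by linarith
  then show ?thesis
    using le mult_left_mono[OF _ assms(2), of 1] by fastforce
qed

section \<open>The bound on the lower modulus and the contradiction\<close>

lemma norm_cis_minus_1_le: "norm (cis t - 1) \<le> \<bar>t\<bar>"
  using dist_exp_i_1[of t] abs_sin_x_le_abs_x[of "t / 2"] by (simp add: cis_conv_exp)

text \<open>The argument of \<open>\<omega>\<close> is the largeness of antipodal displacements,
  while neighbours stay within distance 1, so only \<open>\<Omega> 1\<close> appears. Since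
  \<open>n\<close> is at least \<open>j powr q\<close>, the dimension absorbs the cost of the
  walk.\<close>

lemma (in midpoint_space) lp_coarse_modulus_bound:
  fixes \<omega> \<Omega> :: "real \<Rightarrow> real"
  assumes "0 < p" "mono_on {0..} \<omega>" "mono_on {0..} \<Omega>" "0 \<le> \<Omega> 1"
    and \<phi>: "\<phi> ` lp_set p \<subseteq> X"
    and moduli: "\<And>x y. x \<in> lp_set p \<Longrightarrow> y \<in> lp_set p \<Longrightarrow>
      \<omega> (lp_dist p x y) \<le> d (\<phi> x) (\<phi> y) \<and> d (\<phi> x) (\<phi> y) \<le> \<Omega> (lp_dist p x y)"
    and j: "j > 0" "real j powr q \<le> real n"
  shows "\<omega> (real j / 2 * real (2 * n) powr - inv_exponent p) \<le> 2 * \<Omega> 1 + \<Omega> 1 * c powr (- 1 / q)"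
proof -
  define e where "e = inv_exponent p"
  \<comment> \<open>This radius cancels the factor \<open>real (2 * n) powr e\<close> of
    \<open>lp_dist_circles_le\<close>, leaving neighbours at distance at most pi/4.\<close>
  define a where "a = real j / 2 * real (2 * n) powr - e"
  define z where "z = cis (pi / (2 * real j))"
  define f where "f x = \<phi> (circles n a x)" for x
  define R where "R = \<Omega> 1"
  \<comment> \<open>The solution of \<open>c * M powr q = R powr q\<close>, the largest value the
    cotype inequality allows for \<open>\<omega> a - 2 * R\<close>.\<close>
  define M where "M = R * c powr (- 1 / q)"
  have n: "n > 0" using j by (cases n) auto
  have a: "a \<ge> 0" by (simp add: a_def)
  have M: "M \<ge> 0" using assms(4) by (simp add: M_def R_def)
  have z_half: "z ^ (2 * j) = -1"
    using j unfolding z_def Complex.DeMoivre by simp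
  have z_root: "z ^ (4 * j) = 1"
    using z_half power_mult[of z "2 * j" 2] by simp
  have N: "4 * j > 0" using j by simp
  have f: "f \<in> torus n (4 * j) \<rightarrow> X"
    using \<phi> circles_in_lp_set[OF assms(1)] by (auto simp: f_def)
  have step: "real (2 * n) powr e * (a * norm (z - 1)) \<le> 1"
  proof -
    have "real (2 * n) powr e * (a * norm (z - 1)) = real j / 2 * norm (z - 1)"
      using n by (simp add: a_def powr_minus)
    also have "\<dots> \<le> real j / 2 * (pi / (2 * real j))"
      using norm_cis_minus_1_le[of "pi / (2 * real j)"] by (intro mult_left_mono) (auto simp: z_def)
    also have "\<dots> \<le> 1" using j pi_less_4 by simp
    finally show ?thesis .
  qed
  have close: "d (f y) (f x) \<le> R"
    if "\<And>i. i < n \<Longrightarrow> norm (y i - x i) \<le> norm (z - 1)" for x y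
  proof -
    have "lp_dist p (circles n a y) (circles n a x) \<le> 1"
      using lp_dist_circles_le[where b = "norm (z - 1)", OF assms(1) a _ n] that step
      unfolding e_def by (meson norm_ge_zero order_trans)
    moreover have "0 \<le> lp_dist p (circles n a y) (circles n a x)"
      using abs_diff_le_lp_dist[OF assms(1), where N = "2 * n" and x = "circles n a y" and y = "circles n a x" and k = 0]
      by (auto simp: circles_def)
    ultimately have "\<Omega> (lp_dist p (circles n a y) (circles n a x)) \<le> R"
      unfolding R_def by (intro mono_onD[OF assms(3)]) auto
    then show ?thesis
      using moduli circles_in_lp_set[OF assms(1)] unfolding f_def by (meson order_trans)
  qed
  have far: "\<omega> a \<le> d (f (rot k (-1) x)) (f x)" if "x \<in> torus n (4 * j)" "k < n" for x k
  proof -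
    have "a \<le> lp_dist p (circles n a (rot k (-1) x)) (circles n a x)"
      using that torus_norm N by (intro lp_dist_circles_antipode_ge assms a) auto
    then have "\<omega> a \<le> \<omega> (lp_dist p (circles n a (rot k (-1) x)) (circles n a x))"
      using a by (intro mono_onD[OF assms(2)]) auto
    then show ?thesis
      using moduli circles_in_lp_set[OF assms(1)] unfolding f_def by (meson order_trans)
  qed
  have "\<omega> a \<le> 2 * R + M"
  proof (rule ccontr)
    assume "\<not> ?thesis"
    \<comment> \<open>The negated claim also yields \<open>2 * R \<le> \<omega> a\<close>, a
      hypothesis of \<open>cotype_inequality\<close>.\<close>
    then have gt: "M < \<omega> a - 2 * R" and "2 * R \<le> \<omega> a" using M by auto
    have "real n * (c * (\<omega> a - 2 * R) powr q) \<le> real j powr q * R powr q"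
      using cotype_inequality[OF N z_root f z_half j(1) close far \<open>2 * R \<le> \<omega> a\<close>]
      by (simp add: mult_ac)
    also have "\<dots> \<le> real n * R powr q"
      using j by (intro mult_right_mono) auto
    finally have "c * (\<omega> a - 2 * R) powr q \<le> R powr q"
      using n by simp
    moreover have "R powr q = c * M powr q"
    proof -
      have "(c powr (- 1 / q)) powr q = c powr - 1"
        using q by (simp only: powr_powr) simp
      then show ?thesis
        using c assms(4) by (simp add: M_def R_def powr_mult powr_minus)
    qed
    moreover have "M powr q < (\<omega> a - 2 * R) powr q"
      using gt M q by (intro powr_less_mono2) auto
    ultimately show False using c by auto
  qed
  then show ?thesis by (simp add: a_def e_def M_def R_def)
qed

theorem theorem1p3:
  fixes q :: real and p :: ereal and X :: "'a set" and d :: "'a \<Rightarrow> 'a \<Rightarrow> real"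
  assumes "1 \<le> q" and "ereal q < p"
    and "Metric_space X d"
    and "q_barycentric X d q"
  shows "\<not> coarse_embeds (lp_set p) (lp_dist p) X d"
proof
  assume "coarse_embeds (lp_set p) (lp_dist p) X d"
  then obtain \<omega> \<Omega> \<phi> where mono: "mono_on {0..} \<omega>" "mono_on {0..} \<Omega>"
    and \<Omega>_nonneg: "\<And>t. t \<ge> 0 \<Longrightarrow> 0 \<le> \<Omega> t"
    and lim: "filterlim \<omega> at_top at_top" and \<phi>: "\<phi> ` lp_set p \<subseteq> X"
    and moduli: "\<And>x y. x \<in> lp_set p \<Longrightarrow> y \<in> lp_set p \<Longrightarrow>
      \<omega> (lp_dist p x y) \<le> d (\<phi> x) (\<phi> y) \<and> d (\<phi> x) (\<phi> y) \<le> \<Omega> (lp_dist p x y)"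
    unfolding coarse_embeds_def by metis
  obtain c mid where "c > 0" "\<And>a b. a \<in> X \<Longrightarrow> b \<in> X \<Longrightarrow> mid a b \<in> X"
    "\<And>a b x. a \<in> X \<Longrightarrow> b \<in> X \<Longrightarrow> x \<in> X \<Longrightarrow>
      d (mid a b) x powr q + c * d a b powr q \<le> (d a x powr q + d b x powr q) / 2"
    using q_barycentric_midpoint[OF assms(3,4,1)] by blast
  then interpret midpoint_space X d q c mid
    using assms by (simp add: midpoint_space_def midpoint_space_axioms_def)
  have p: "0 < p" using assms(1,2) by (metis ereal_less(2) less_trans less_le_trans zero_less_one)
  define e where "e = inv_exponent p"
  \<comment> \<open>The assumption \<open>q < p\<close> enters here; the exponent
    \<open>1 - q * e\<close> is the growth rate of the antipodal distances.\<close>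
  have e: "0 \<le> e" "q * e < 1"
    using assms(1,2) p by (cases p; simp add: e_def inv_exponent_def divide_simps)+
  define K where "K = 2 * \<Omega> 1 + \<Omega> 1 * c powr (- 1 / q)"
  \<comment> \<open>The radius for the least dimension \<open>n\<close> with
    \<open>real j powr q \<le> real n\<close>.\<close>
  define L where "L j = real j / 2 * real (2 * nat \<lceil>real j powr q\<rceil>) powr - e" for j :: nat
  have bound: "\<omega> (L j) \<le> K" if "j > 0" for j
    unfolding L_def K_def e_def
    by (rule lp_coarse_modulus_bound) (use p mono \<Omega>_nonneg \<phi> moduli that in \<open>auto simp: real_nat_ceiling_ge\<close>)
  have L_ge: "4 powr - e / 2 * real j powr (1 - q * e) \<le> L j" if "j > 0" for j
  proof -
    have "1 \<le> real j powr q" using that assms(1) by (simp add: ge_one_powr_ge_zero)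
    \<comment> \<open>For \<open>t \<ge> 1\<close> the ceiling of \<open>t\<close> is at most
      \<open>t + 1 \<le> 2 * t\<close>, whence the constant 4.\<close>
    then have "real (2 * nat \<lceil>real j powr q\<rceil>) \<le> 4 * real j powr q" "0 < nat \<lceil>real j powr q\<rceil>"
      by linarith+
    then have "(4 * real j powr q) powr - e \<le> real (2 * nat \<lceil>real j powr q\<rceil>) powr - e"
      using e by (intro powr_mono2') auto
    then have "real j / 2 * (4 * real j powr q) powr - e \<le> L j"
      unfolding L_def by (intro mult_left_mono) auto
    moreover have "real j / 2 * (4 * real j powr q) powr - e = 4 powr - e / 2 * real j powr (1 - q * e)"
      using that by (simp add: powr_mult powr_powr powr_diff powr_minus field_simps)
    ultimately show ?thesis by simp
  qed
  have "filterlim (\<lambda>j. 4 powr - e / 2 * real j powr (1 - q * e)) at_top sequentially"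
    using e by (intro filterlim_tendsto_pos_mult_at_top[OF tendsto_const])
      (auto intro!: filterlim_compose[OF real_powr_at_top] filterlim_real_sequentially)
  then have "filterlim L at_top sequentially"
    by (rule filterlim_at_top_mono) (use L_ge in \<open>auto simp: eventually_sequentially intro!: exI[of _ 1]\<close>)
  then have "filterlim (\<lambda>j. \<omega> (L j)) at_top sequentially"
    by (rule filterlim_compose[OF lim])
  then have "eventually (\<lambda>j. K < \<omega> (L j) \<and> 0 < j) sequentially"
    by (intro eventually_conj eventually_gt_at_top) (simp add: filterlim_at_top_dense)
  then obtain j where "K < \<omega> (L j)" "0 < j"
    using eventually_happens'[OF sequentially_bot] by blast
  then show False using bound[of j] by simp
qed

end
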